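(* Let $R$ be a commutative ring with identity and let $M$ be a nonzero $R$-module. Then the following are equivalent: (1) $M$ is a strongly CS $R$-module; (2) for any submodules $N$ and $L$ of $M$ with $N\cap L=0$, there exists an idempotent $e\in R$ such that $e\in \mathrm{Ann}_R(N)$ and $1-e\in \mathrm{Ann}_R(L)$; (3) $M$ is a weakly IN $R$-module and idempotents lift modulo $\mathrm{Ann}_R(M)$; (4) $M$ is a CS module and for every direct summand $K$ of $M$, there exists an idempotent $e$ of $R$ such that $K=eM$.
   Context: All rings are commutative with identity and all modules are unital. For an $R$-module $M$, $\mathrm{Ann}_R(M)=\{r\in R\mid rM=0\}$. A submodule $N\le M$ is essential in $M$ if $N\cap L\neq 0$ for every nonzero submodule $L\le M$. An $R$-module $M$ is CS if every submodule of $M$ is an essential submodule of a direct summand of $M$. $M$ is weakly IN if $\mathrm{Ann}_R(N)+\mathrm{Ann}_R(L)=R$ for all submodules $N,L$ of $M$ with $N\cap L=0$. $M$ is strongly CS if for every submodule $N$ of $M$ there exists an idempotent $e=e^2\in R$ such that $N$ is an essential submodule of $eM$. For a proper ideal $I$ of $R$, idempotents lift modulo $I$ if whenever $r\in R$ satisfies $r-r^2\in I$, there exists $e=e^2\in R$ with $r-e\in I$. *)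

theory Defs
  imports "HOL-Algebra.Module" "HOL-Algebra.AbelCoset"
begin

definition annihilator ::
  "('a, 'c) ring_scheme \<Rightarrow> ('a, 'b, 'd) module_scheme \<Rightarrow> 'b set \<Rightarrow> 'a set"
  where "annihilator R M N = {r \<in> carrier R. \<forall>x\<in>N. r \<odot>\<^bsub>M\<^esub> x = \<zero>\<^bsub>M\<^esub>}"

definition idempotent_elem :: "('a, 'c) ring_scheme \<Rightarrow> 'a \<Rightarrow> bool"
  where "idempotent_elem R e \<longleftrightarrow> e \<in> carrier R \<and> e \<otimes>\<^bsub>R\<^esub> e = e"

definition smult_image ::
  "('a, 'b, 'd) module_scheme \<Rightarrow> 'a \<Rightarrow> 'b set"
  where "smult_image M r = (\<lambda>x. r \<odot>\<^bsub>M\<^esub> x) ` carrier M"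

text \<open>
  A submodule \<open>K\<close> of \<open>M\<close>, regarded as a module in its own right, is \<open>M\<lparr>carrier := K\<rparr>\<close>;
  so ``\<open>N\<close> is an essential submodule of \<open>K\<close>'' is
  \<open>essential_submodule R (M\<lparr>carrier := K\<rparr>) N\<close>, which includes \<open>N \<subseteq> K\<close>.
\<close>

definition essential_submodule ::
  "('a, 'c) ring_scheme \<Rightarrow> ('a, 'b, 'd) module_scheme \<Rightarrow> 'b set \<Rightarrow> bool"
  where "essential_submodule R M N \<longleftrightarrow>
    submodule N R M \<and>
    (\<forall>L. submodule L R M \<longrightarrow> L \<noteq> {\<zero>\<^bsub>M\<^esub>} \<longrightarrow> N \<inter> L \<noteq> {\<zero>\<^bsub>M\<^esub>})"

definition direct_summand ::
  "('a, 'c) ring_scheme \<Rightarrow> ('a, 'b, 'd) module_scheme \<Rightarrow> 'b set \<Rightarrow> bool"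
  where "direct_summand R M K \<longleftrightarrow>
    submodule K R M \<and>
    (\<exists>L. submodule L R M \<and> K \<inter> L = {\<zero>\<^bsub>M\<^esub>} \<and> K <+>\<^bsub>M\<^esub> L = carrier M)"

definition CS_module ::
  "('a, 'c) ring_scheme \<Rightarrow> ('a, 'b, 'd) module_scheme \<Rightarrow> bool"
  where "CS_module R M \<longleftrightarrow>
    (\<forall>N. submodule N R M \<longrightarrow>
      (\<exists>K. direct_summand R M K \<and> essential_submodule R (M\<lparr>carrier := K\<rparr>) N))"

definition weakly_IN_module ::
  "('a, 'c) ring_scheme \<Rightarrow> ('a, 'b, 'd) module_scheme \<Rightarrow> bool"
  where "weakly_IN_module R M \<longleftrightarrow>
    (\<forall>N L. submodule N R M \<longrightarrow> submodule L R M \<longrightarrow> N \<inter> L = {\<zero>\<^bsub>M\<^esub>} \<longrightarrow>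
      annihilator R M N <+>\<^bsub>R\<^esub> annihilator R M L = carrier R)"

definition strongly_CS_module ::
  "('a, 'c) ring_scheme \<Rightarrow> ('a, 'b, 'd) module_scheme \<Rightarrow> bool"
  where "strongly_CS_module R M \<longleftrightarrow>
    (\<forall>N. submodule N R M \<longrightarrow>
      (\<exists>e. idempotent_elem R e \<and>
        essential_submodule R (M\<lparr>carrier := smult_image M e\<rparr>) N))"

text \<open>
  This is meant for proper ideals \<open>I\<close>; the annihilator of a nonzero module is one.
\<close>

definition idempotents_lift ::
  "('a, 'c) ring_scheme \<Rightarrow> 'a set \<Rightarrow> bool"
  where "idempotents_lift R I \<longleftrightarrow>
    (\<forall>r\<in>carrier R. r \<ominus>\<^bsub>R\<^esub> r \<otimes>\<^bsub>R\<^esub> r \<in> I \<longrightarrow>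
      (\<exists>e. idempotent_elem R e \<and> r \<ominus>\<^bsub>R\<^esub> e \<in> I))"

end

theory Submission
  imports Defs
begin

text \<open>
  All four conditions speak about how scalars act on a pair of submodules \<open>N\<close>, \<open>L\<close> with
  \<open>N \<inter> L = 0\<close>. Call a scalar \<open>r\<close> separating for the pair if it acts as \<open>0\<close> on \<open>N\<close> and as the
  identity on \<open>L\<close>. Then \<open>Ann(N) + Ann(L) = R\<close> says that some scalar separates the pair, whereas
  condition (2) asks for a separating idempotent. The theorem thus becomes a comparison between
  separating scalars, separating idempotents and direct summands of the form \<open>eM\<close>.

  If \<open>L\<close> is essential in \<open>eM\<close> and \<open>N \<inter> L = 0\<close>, then \<open>N \<inter> eM = 0\<close>; as \<open>eN\<close> lies in this
  intersection, \<open>e\<close> separates \<open>N\<close> from \<open>L\<close>. Conversely, let \<open>L\<close> be a maximal submodule with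
  \<open>L \<inter> N = 0\<close>, and let \<open>e\<close> be an idempotent that kills \<open>L\<close> and fixes \<open>N\<close>. A submodule \<open>K\<close> of
  \<open>eM\<close> that misses \<open>N\<close> can be added to \<open>L\<close> without meeting \<open>N\<close>, so \<open>K\<close> lies in \<open>L\<close> by
  maximality and \<open>K = eK = 0\<close>: hence \<open>N\<close> is essential in \<open>eM\<close>. This is (1) \<open>\<longleftrightarrow>\<close> (2).
  Applied to a decomposition \<open>M = K \<oplus> L\<close>, a separating idempotent gives \<open>K = eM\<close>, and every
  \<open>eM\<close> is a direct summand; this yields (4). In the other direction, (4) provides a direct summand
  in which \<open>N\<close> is essential and writes it as \<open>eM\<close>, which is (1).

  An element \<open>r\<close> with \<open>r - r\<^sup>2\<close> in \<open>Ann(M)\<close> acts as a projection on \<open>M\<close>, and an idempotent that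
  separates its kernel from its image acts as \<open>r\<close> does. So (2) implies that idempotents lift.
  The step with content is (3) \<open>\<longrightarrow>\<close> (2), since a separating scalar \<open>a\<close> need not be idempotent
  modulo \<open>Ann(M)\<close>. It is so, however, when \<open>N\<close> and \<open>L\<close> are each maximal among the submodules
  that miss the other (lemma \<open>separating_scalar_idempotent_on_module\<close>); by Zorn's lemma, every
  pair can be enlarged to such a pair. A lift of \<open>a\<close> then acts on \<open>M\<close> as \<open>a\<close> does, and so it
  separates the original pair as well.
\<close>

section \<open>Separating scalars\<close>

definition separates ::
  "('a, 'c) ring_scheme \<Rightarrow> ('a, 'b, 'd) module_scheme \<Rightarrow> 'b set \<Rightarrow> 'b set \<Rightarrow> 'a \<Rightarrow> bool"
  where "separates R M N L r \<longleftrightarrow>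
    r \<in> carrier R \<and> (\<forall>x\<in>N. r \<odot>\<^bsub>M\<^esub> x = \<zero>\<^bsub>M\<^esub>) \<and> (\<forall>x\<in>L. r \<odot>\<^bsub>M\<^esub> x = x)"

lemma (in abelian_group) diff_eq_zero_iff:
  assumes "x \<in> carrier G" "y \<in> carrier G"
  shows "x \<ominus> y = \<zero> \<longleftrightarrow> x = y"
  using assms by (metis a_minus_def a_inv_closed minus_equality r_neg minus_minus)

lemma (in module) smult_diff_left:
  assumes "r \<in> carrier R" "s \<in> carrier R" "x \<in> carrier M"
  shows "(r \<ominus> s) \<odot>\<^bsub>M\<^esub> x = r \<odot>\<^bsub>M\<^esub> x \<ominus>\<^bsub>M\<^esub> s \<odot>\<^bsub>M\<^esub> x"
  using assms by (simp add: R.minus_eq M.minus_eq smult_l_distr smult_l_minus)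

lemma (in module) smult_diff_right:
  assumes "r \<in> carrier R" "x \<in> carrier M" "y \<in> carrier M"
  shows "r \<odot>\<^bsub>M\<^esub> (x \<ominus>\<^bsub>M\<^esub> y) = r \<odot>\<^bsub>M\<^esub> x \<ominus>\<^bsub>M\<^esub> r \<odot>\<^bsub>M\<^esub> y"
  using assms by (simp add: M.minus_eq smult_r_distr smult_r_minus)

lemma (in module) smult_left_commute:
  assumes "a \<in> carrier R" "b \<in> carrier R" "x \<in> carrier M"
  shows "a \<odot>\<^bsub>M\<^esub> (b \<odot>\<^bsub>M\<^esub> x) = b \<odot>\<^bsub>M\<^esub> (a \<odot>\<^bsub>M\<^esub> x)"
  using assms by (metis R.m_comm smult_assoc1)

text \<open>
  Membership in an annihilator becomes a statement about actions. The elements \<open>1 - e\<close> and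
  \<open>r - r\<^sup>2\<close> that occur in the four conditions are instances of the difference treated here.
\<close>

lemma (in module) diff_in_annihilator_iff:
  assumes "r \<in> carrier R" "s \<in> carrier R" "N \<subseteq> carrier M"
  shows "r \<ominus> s \<in> annihilator R M N \<longleftrightarrow> (\<forall>x\<in>N. r \<odot>\<^bsub>M\<^esub> x = s \<odot>\<^bsub>M\<^esub> x)"
proof -
  have "(r \<ominus> s) \<odot>\<^bsub>M\<^esub> x = \<zero>\<^bsub>M\<^esub> \<longleftrightarrow> r \<odot>\<^bsub>M\<^esub> x = s \<odot>\<^bsub>M\<^esub> x" if "x \<in> N" for x
    using assms that by (auto simp: smult_diff_left M.diff_eq_zero_iff subset_eq)
  then show ?thesis
    using assms by (auto simp: annihilator_def)
qed

lemma (in module) separates_iff_annihilator: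
  assumes "L \<subseteq> carrier M"
  shows "separates R M N L r \<longleftrightarrow>
    r \<in> annihilator R M N \<and> \<one> \<ominus> r \<in> annihilator R M L"
proof (cases "r \<in> carrier R")
  case True
  then have "\<one> \<ominus> r \<in> annihilator R M L \<longleftrightarrow> (\<forall>x\<in>L. r \<odot>\<^bsub>M\<^esub> x = x)"
    using assms by (subst diff_in_annihilator_iff) (auto simp: subset_eq)
  with True show ?thesis
    by (auto simp: separates_def annihilator_def)
qed (simp add: separates_def annihilator_def)

text \<open>
  Annihilators are ideals, so they are comaximal as soon as their sum contains \<open>1\<close>; in a
  decomposition \<open>1 = r + (1 - r)\<close> the first summand is the separating scalar.
\<close>

lemma (in module) comaximal_annihilators_iff_separates:
  assumes N: "N \<subseteq> carrier M" and L: "L \<subseteq> carrier M"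
  shows "annihilator R M N <+>\<^bsub>R\<^esub> annihilator R M L = carrier R \<longleftrightarrow> (\<exists>r. separates R M N L r)"
proof
  assume "annihilator R M N <+>\<^bsub>R\<^esub> annihilator R M L = carrier R"
  then have "\<one> \<in> annihilator R M N <+>\<^bsub>R\<^esub> annihilator R M L"
    by simp
  then obtain a b where ab: "a \<in> annihilator R M N" "b \<in> annihilator R M L" "\<one> = a \<oplus> b"
    by (auto simp: set_add_def')
  then have car: "a \<in> carrier R" "b \<in> carrier R"
    by (auto simp: annihilator_def)
  then have "\<one> \<ominus> a = b"
    unfolding ab(3) by (simp add: R.minus_eq R.a_comm[of a b] R.a_assoc R.r_neg)
  with ab L show "\<exists>r. separates R M N L r"
    by (auto simp: separates_iff_annihilator)
next
  assume "\<exists>r. separates R M N L r"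
  then obtain a where a: "a \<in> carrier R" "a \<in> annihilator R M N" "\<one> \<ominus> a \<in> annihilator R M L"
    using separates_iff_annihilator[OF L] by (auto simp: separates_def)
  have scale: "s \<otimes> r \<in> annihilator R M K"
    if "s \<in> carrier R" "r \<in> annihilator R M K" "K \<subseteq> carrier M" for s r K
    using that by (auto simp: annihilator_def smult_assoc1 subset_eq)
  show "annihilator R M N <+>\<^bsub>R\<^esub> annihilator R M L = carrier R"
  proof
    show "annihilator R M N <+>\<^bsub>R\<^esub> annihilator R M L \<subseteq> carrier R"
      by (auto simp: set_add_def' annihilator_def)
    show "carrier R \<subseteq> annihilator R M N <+>\<^bsub>R\<^esub> annihilator R M L"
    proof
      fix s assume s: "s \<in> carrier R"
      have "a \<oplus> (\<one> \<ominus> a) = \<one>"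
        using a(1) by (simp add: R.minus_eq R.a_lcomm[of a \<one>] R.r_neg)
      then have "s = s \<otimes> a \<oplus> s \<otimes> (\<one> \<ominus> a)"
        using s a(1) by (simp flip: R.r_distr)
      with scale[OF s a(2) N] scale[OF s a(3) L]
      show "s \<in> annihilator R M N <+>\<^bsub>R\<^esub> annihilator R M L"
        unfolding set_add_def' by blast
    qed
  qed
qed

lemma (in module) weakly_IN_iff_separates:
  "weakly_IN_module R M \<longleftrightarrow>
    (\<forall>N L. submodule N R M \<longrightarrow> submodule L R M \<longrightarrow> N \<inter> L = {\<zero>\<^bsub>M\<^esub>} \<longrightarrow>
      (\<exists>r. separates R M N L r))"
  unfolding weakly_IN_module_def
  by (simp add: comaximal_annihilators_iff_separates submoduleE(1))

section \<open>Submodules\<close>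

lemma submodule_zero_mem:
  assumes "submodule N R M"
  shows "\<zero>\<^bsub>M\<^esub> \<in> N"
  using subgroup.one_closed[OF submodule.axioms(1)[OF assms]] by simp

lemma (in module) submodule_restrict_iff:
  assumes "submodule K R M"
  shows "submodule L R (M\<lparr>carrier := K\<rparr>) \<longleftrightarrow> submodule L R M \<and> L \<subseteq> K"
proof -
  interpret K: module R "M\<lparr>carrier := K\<rparr>"
    using submodule.submodule_is_module[OF assms module_axioms] .
  have K: "K \<subseteq> carrier M"
    by (rule submoduleE(1)[OF assms])
  show ?thesis
  proof (intro iffI conjI)
    assume L: "submodule L R (M\<lparr>carrier := K\<rparr>)"
    from K.submoduleE(1)[OF L] show "L \<subseteq> K"
      by simp
    then show "submodule L R M"
      using submodule.submodule_is_module[OF L K.module_axioms] K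
      by (intro module_incl_imp_submodule) auto
  next
    assume L: "submodule L R M \<and> L \<subseteq> K"
    then show "submodule L R (M\<lparr>carrier := K\<rparr>)"
      using submodule.submodule_is_module[of L R M] module_axioms
      by (intro K.module_incl_imp_submodule) auto
  qed
qed

lemma (in module) submodule_Int:
  assumes "submodule N R M" "submodule L R M"
  shows "submodule (N \<inter> L) R M"
  using submoduleE[OF assms(1)] submoduleE[OF assms(2)] assms[THEN submodule_zero_mem]
  by (intro submoduleI) auto

lemma (in module) submodule_set_add:
  assumes N: "submodule N R M" and L: "submodule L R M"
  shows "submodule (N <+>\<^bsub>M\<^esub> L) R M"
    and "N \<subseteq> N <+>\<^bsub>M\<^esub> L"
    and "L \<subseteq> N <+>\<^bsub>M\<^esub> L"
proof -
  have car: "x \<in> carrier M" if "x \<in> N \<or> x \<in> L" for x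
    using that submoduleE(1)[OF N] submoduleE(1)[OF L] by auto
  have sumI: "n \<oplus>\<^bsub>M\<^esub> l \<in> N <+>\<^bsub>M\<^esub> L" if "n \<in> N" "l \<in> L" for n l
    using that unfolding set_add_def' by blast
  show "N \<subseteq> N <+>\<^bsub>M\<^esub> L"
  proof
    fix x assume "x \<in> N"
    then have "x = x \<oplus>\<^bsub>M\<^esub> \<zero>\<^bsub>M\<^esub>"
      using car by simp
    with sumI[OF \<open>x \<in> N\<close> submodule_zero_mem[OF L]] show "x \<in> N <+>\<^bsub>M\<^esub> L"
      by simp
  qed
  show "L \<subseteq> N <+>\<^bsub>M\<^esub> L"
  proof
    fix x assume "x \<in> L"
    then have "x = \<zero>\<^bsub>M\<^esub> \<oplus>\<^bsub>M\<^esub> x"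
      using car by simp
    with sumI[OF submodule_zero_mem[OF N] \<open>x \<in> L\<close>] show "x \<in> N <+>\<^bsub>M\<^esub> L"
      by simp
  qed
  show "submodule (N <+>\<^bsub>M\<^esub> L) R M"
  proof (rule submoduleI)
    show "N <+>\<^bsub>M\<^esub> L \<subseteq> carrier M"
      using car by (auto simp: set_add_def')
    show "\<zero>\<^bsub>M\<^esub> \<in> N <+>\<^bsub>M\<^esub> L"
      using \<open>N \<subseteq> N <+>\<^bsub>M\<^esub> L\<close> submodule_zero_mem[OF N] by auto
  next
    fix x assume "x \<in> N <+>\<^bsub>M\<^esub> L"
    then obtain n l where x: "n \<in> N" "l \<in> L" "x = n \<oplus>\<^bsub>M\<^esub> l"
      by (auto simp: set_add_def')
    then have "\<ominus>\<^bsub>M\<^esub> x = \<ominus>\<^bsub>M\<^esub> n \<oplus>\<^bsub>M\<^esub> \<ominus>\<^bsub>M\<^esub> l"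
      using car by (simp add: M.minus_add)
    with sumI[OF submoduleE(3)[OF N x(1)] submoduleE(3)[OF L x(2)]]
    show "\<ominus>\<^bsub>M\<^esub> x \<in> N <+>\<^bsub>M\<^esub> L"
      by simp
  next
    fix x y assume "x \<in> N <+>\<^bsub>M\<^esub> L" "y \<in> N <+>\<^bsub>M\<^esub> L"
    then obtain n l n' l' where xy: "n \<in> N" "l \<in> L" "x = n \<oplus>\<^bsub>M\<^esub> l"
        "n' \<in> N" "l' \<in> L" "y = n' \<oplus>\<^bsub>M\<^esub> l'"
      by (auto simp: set_add_def')
    then have "x \<oplus>\<^bsub>M\<^esub> y = (n \<oplus>\<^bsub>M\<^esub> n') \<oplus>\<^bsub>M\<^esub> (l \<oplus>\<^bsub>M\<^esub> l')"
      using car by (simp add: M.a_ac)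
    with sumI[OF submoduleE(5)[OF N xy(1,4)] submoduleE(5)[OF L xy(2,5)]]
    show "x \<oplus>\<^bsub>M\<^esub> y \<in> N <+>\<^bsub>M\<^esub> L"
      by simp
  next
    fix a x assume a: "a \<in> carrier R" and "x \<in> N <+>\<^bsub>M\<^esub> L"
    then obtain n l where x: "n \<in> N" "l \<in> L" "x = n \<oplus>\<^bsub>M\<^esub> l"
      by (auto simp: set_add_def')
    then have "a \<odot>\<^bsub>M\<^esub> x = a \<odot>\<^bsub>M\<^esub> n \<oplus>\<^bsub>M\<^esub> a \<odot>\<^bsub>M\<^esub> l"
      using car a by (simp add: smult_r_distr)
    with sumI[OF submoduleE(4)[OF N a x(1)] submoduleE(4)[OF L a x(2)]]
    show "a \<odot>\<^bsub>M\<^esub> x \<in> N <+>\<^bsub>M\<^esub> L"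
      by simp
  qed
qed

definition smult_kernel :: "('a, 'b, 'd) module_scheme \<Rightarrow> 'a \<Rightarrow> 'b set"
  where "smult_kernel M r = {x \<in> carrier M. r \<odot>\<^bsub>M\<^esub> x = \<zero>\<^bsub>M\<^esub>}"

lemma (in module) submodule_smult_kernel:
  assumes "r \<in> carrier R"
  shows "submodule (smult_kernel M r) R M"
  using assms
  by (intro submoduleI)
    (auto simp: smult_kernel_def smult_r_minus smult_r_distr smult_left_commute[of r])

lemma (in module) submodule_smult_image:
  assumes r: "r \<in> carrier R"
  shows "submodule (smult_image M r) R M"
proof (rule submoduleI)
  show "smult_image M r \<subseteq> carrier M"
    using r by (auto simp: smult_image_def)
  show "\<zero>\<^bsub>M\<^esub> \<in> smult_image M r"
    using r smult_r_null[OF r] unfolding smult_image_def by (metis M.zero_closed imageI)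
next
  fix x assume "x \<in> smult_image M r"
  then show "\<ominus>\<^bsub>M\<^esub> x \<in> smult_image M r"
    using r by (auto simp: smult_image_def simp flip: smult_r_minus)
next
  fix x y assume "x \<in> smult_image M r" "y \<in> smult_image M r"
  then show "x \<oplus>\<^bsub>M\<^esub> y \<in> smult_image M r"
    using r by (auto simp: smult_image_def simp flip: smult_r_distr)
next
  fix a x assume "a \<in> carrier R" "x \<in> smult_image M r"
  then show "a \<odot>\<^bsub>M\<^esub> x \<in> smult_image M r"
    using r by (auto simp: smult_image_def smult_left_commute[of a r])
qed

lemma (in module) smult_image_eq_fixed_points:
  assumes "idempotent_elem R e"
  shows "smult_image M e = {x \<in> carrier M. e \<odot>\<^bsub>M\<^esub> x = x}"
proof -
  have e: "e \<in> carrier R" "e \<otimes> e = e"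
    using assms by (auto simp: idempotent_elem_def)
  have "e \<odot>\<^bsub>M\<^esub> (e \<odot>\<^bsub>M\<^esub> x) = e \<odot>\<^bsub>M\<^esub> x" if "x \<in> carrier M" for x
    using e that by (simp flip: smult_assoc1)
  then show ?thesis
    using e(1) by (force simp: smult_image_def)
qed

section \<open>Essential submodules and maximal disjoint submodules\<close>

lemma (in module) essential_submodule_restrict_iff:
  assumes K: "submodule K R M"
  shows "essential_submodule R (M\<lparr>carrier := K\<rparr>) N \<longleftrightarrow>
    submodule N R M \<and> N \<subseteq> K \<and>
    (\<forall>L. submodule L R M \<longrightarrow> L \<subseteq> K \<longrightarrow> N \<inter> L = {\<zero>\<^bsub>M\<^esub>} \<longrightarrow> L = {\<zero>\<^bsub>M\<^esub>})"
  unfolding essential_submodule_def submodule_restrict_iff[OF K] by auto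

text \<open>The submodules described next are usually called complements of \<open>L\<close> in \<open>M\<close>.\<close>

definition maximal_disjoint ::
  "('a, 'c) ring_scheme \<Rightarrow> ('a, 'b, 'd) module_scheme \<Rightarrow> 'b set \<Rightarrow> 'b set \<Rightarrow> bool"
  where "maximal_disjoint R M N L \<longleftrightarrow>
    submodule N R M \<and> N \<inter> L = {\<zero>\<^bsub>M\<^esub>} \<and>
    (\<forall>X. submodule X R M \<longrightarrow> N \<subseteq> X \<longrightarrow> X \<inter> L = {\<zero>\<^bsub>M\<^esub>} \<longrightarrow> X = N)"

lemma (in module) submodule_Union_chain:
  assumes sub: "\<And>X. X \<in> C \<Longrightarrow> submodule X R M"
    and chain: "subset.chain A C" and ne: "C \<noteq> {}"
  shows "submodule (\<Union>C) R M"
proof (rule submoduleI)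
  show "\<Union>C \<subseteq> carrier M"
    using submoduleE(1)[OF sub] by blast
  show "\<zero>\<^bsub>M\<^esub> \<in> \<Union>C"
    using submodule_zero_mem[OF sub] ne by blast
  show "\<ominus>\<^bsub>M\<^esub> x \<in> \<Union>C" if "x \<in> \<Union>C" for x
    using that submoduleE(3)[OF sub] by blast
  show "a \<odot>\<^bsub>M\<^esub> x \<in> \<Union>C" if "a \<in> carrier R" "x \<in> \<Union>C" for a x
    using that submoduleE(4)[OF sub] by blast
next
  fix x y assume "x \<in> \<Union>C" "y \<in> \<Union>C"
  then obtain X Y where XY: "X \<in> C" "Y \<in> C" "x \<in> X" "y \<in> Y"
    by blast
  with chain have "X \<subseteq> Y \<or> Y \<subseteq> X"
    by (auto simp: subset_chain_def)
  with XY obtain Z where "Z \<in> C" "x \<in> Z" "y \<in> Z"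
    by blast
  then show "x \<oplus>\<^bsub>M\<^esub> y \<in> \<Union>C"
    using submoduleE(5)[OF sub] by blast
qed

lemma (in module) exists_maximal_disjoint:
  assumes N: "submodule N R M" and disj: "N \<inter> L = {\<zero>\<^bsub>M\<^esub>}"
  obtains N' where "N \<subseteq> N'" "maximal_disjoint R M N' L"
proof -
  define A where "A = {X. submodule X R M \<and> N \<subseteq> X \<and> X \<inter> L = {\<zero>\<^bsub>M\<^esub>}}"
  have "\<Union>C \<in> A" if "C \<noteq> {}" "subset.chain A C" for C
  proof -
    from that(2) have C: "X \<in> A" if "X \<in> C" for X
      using that by (auto simp: subset_chain_def)
    then have "submodule (\<Union>C) R M"
      using that submodule_Union_chain by (auto simp: A_def)
    with C \<open>C \<noteq> {}\<close> show ?thesis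
      unfolding A_def by blast
  qed
  moreover have "A \<noteq> {}"
    using N disj by (auto simp: A_def)
  ultimately obtain N' where "N' \<in> A" "\<forall>X\<in>A. N' \<subseteq> X \<longrightarrow> X = N'"
    using subset_Zorn_nonempty[of A] by blast
  then show thesis
    by (intro that[of N']) (auto simp: A_def maximal_disjoint_def)
qed

lemma (in module) maximal_disjoint_absorbs:
  assumes N: "maximal_disjoint R M N L" and K: "submodule K R M"
    and disj: "\<And>n k. n \<in> N \<Longrightarrow> k \<in> K \<Longrightarrow> n \<oplus>\<^bsub>M\<^esub> k \<in> L \<Longrightarrow> n \<oplus>\<^bsub>M\<^esub> k = \<zero>\<^bsub>M\<^esub>"
  shows "K \<subseteq> N"
proof -
  have subN: "submodule N R M" and 0: "\<zero>\<^bsub>M\<^esub> \<in> L"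
    using N unfolding maximal_disjoint_def by blast+
  note sum = submodule_set_add[OF subN K]
  have "(N <+>\<^bsub>M\<^esub> K) \<inter> L = {\<zero>\<^bsub>M\<^esub>}"
    using disj 0 submodule_zero_mem[OF sum(1)] by (auto simp: set_add_def')
  then have "N <+>\<^bsub>M\<^esub> K = N"
    using N sum unfolding maximal_disjoint_def by blast
  with sum(3) show ?thesis
    by simp
qed

lemma (in module) smult_kernel_eq_maximal_disjoint:
  assumes N: "maximal_disjoint R M N L" and r: "separates R M N L r"
  shows "smult_kernel M r = N"
proof -
  have sub: "submodule N R M" and disj: "N \<inter> L = {\<zero>\<^bsub>M\<^esub>}"
    using N unfolding maximal_disjoint_def by blast+
  have rR: "r \<in> carrier R"
    using r unfolding separates_def by blast
  have le: "N \<subseteq> smult_kernel M r"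
    using r submoduleE(1)[OF sub] unfolding smult_kernel_def separates_def by blast
  moreover have "smult_kernel M r \<inter> L = {\<zero>\<^bsub>M\<^esub>}"
  proof
    show "smult_kernel M r \<inter> L \<subseteq> {\<zero>\<^bsub>M\<^esub>}"
      using r unfolding smult_kernel_def separates_def by force
    show "{\<zero>\<^bsub>M\<^esub>} \<subseteq> smult_kernel M r \<inter> L"
      using le disj by blast
  qed
  ultimately show ?thesis
    using N submodule_smult_kernel[OF rR] unfolding maximal_disjoint_def by blast
qed

text \<open>
  The square of a separating scalar separates the same pair, so both have the same kernel.
\<close>

lemma (in module) separates_square_kernel:
  assumes N: "maximal_disjoint R M N L" and r: "separates R M N L r"
    and x: "x \<in> carrier M" and 0: "r \<odot>\<^bsub>M\<^esub> (r \<odot>\<^bsub>M\<^esub> x) = \<zero>\<^bsub>M\<^esub>" and L: "L \<subseteq> carrier M"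
  shows "r \<odot>\<^bsub>M\<^esub> x = \<zero>\<^bsub>M\<^esub>"
proof -
  have car: "r \<in> carrier R" "N \<subseteq> carrier M"
    using N r submoduleE(1) by (auto simp: maximal_disjoint_def separates_def)
  have "separates R M N L (r \<otimes> r)"
    using r car L by (auto simp: separates_def smult_assoc1 subset_eq)
  then have "smult_kernel M (r \<otimes> r) = smult_kernel M r"
    using smult_kernel_eq_maximal_disjoint[OF N] r by simp
  then show ?thesis
    using x 0 car by (auto simp: smult_kernel_def smult_assoc1)
qed

section \<open>The implications\<close>

text \<open>
  With \<open>b = 1 - a\<close>, the claim is \<open>abM = 0\<close>. The scalar \<open>a\<close> separates \<open>N\<close> from \<open>L\<close> and \<open>b\<close>
  separates \<open>L\<close> from \<open>N\<close>, so by maximality on both sides neither kernel grows when the scalar is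
  squared. Since \<open>ab\<close> kills \<open>N\<close> and \<open>L\<close>, an element \<open>n + aby\<close> of \<open>L\<close> satisfies
  \<open>a\<^sup>2b\<^sup>2y = 0\<close>, hence \<open>aby = 0\<close>. So \<open>N + abM\<close> still misses \<open>L\<close> and \<open>abM\<close> lies in \<open>N\<close>, which
  is killed by \<open>a\<close>; then \<open>a\<^sup>2by = 0\<close> and therefore \<open>aby = 0\<close> for every \<open>y\<close>.
\<close>

lemma (in module) separating_scalar_idempotent_on_module:
  assumes N: "maximal_disjoint R M N L" and L: "maximal_disjoint R M L N"
    and a: "separates R M N L a" and y: "y \<in> carrier M"
  shows "a \<odot>\<^bsub>M\<^esub> (a \<odot>\<^bsub>M\<^esub> y) = a \<odot>\<^bsub>M\<^esub> y"
proof -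
  have sub: "submodule N R M" "submodule L R M" and disj: "N \<inter> L = {\<zero>\<^bsub>M\<^esub>}"
    using N L by (auto simp: maximal_disjoint_def)
  note car = sub[THEN submoduleE(1)]
  have aR: "a \<in> carrier R"
    using a by (simp add: separates_def)
  define b where "b = \<one> \<ominus> a"
  have bR: "b \<in> carrier R"
    using aR by (simp add: b_def)
  have b_act: "b \<odot>\<^bsub>M\<^esub> x = x \<ominus>\<^bsub>M\<^esub> a \<odot>\<^bsub>M\<^esub> x" if "x \<in> carrier M" for x
    using aR that by (simp add: b_def smult_diff_left)
  have b: "separates R M L N b"
    using a aR bR car by (auto simp: separates_def b_act subset_eq M.minus_eq M.r_neg)
  have ab_kernel: "a \<odot>\<^bsub>M\<^esub> (b \<odot>\<^bsub>M\<^esub> x) = \<zero>\<^bsub>M\<^esub>"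
    if x: "x \<in> carrier M" and 0: "a \<odot>\<^bsub>M\<^esub> (b \<odot>\<^bsub>M\<^esub> (a \<odot>\<^bsub>M\<^esub> (b \<odot>\<^bsub>M\<^esub> x))) = \<zero>\<^bsub>M\<^esub>" for x
  proof -
    have "a \<odot>\<^bsub>M\<^esub> (a \<odot>\<^bsub>M\<^esub> (b \<odot>\<^bsub>M\<^esub> (b \<odot>\<^bsub>M\<^esub> x))) = \<zero>\<^bsub>M\<^esub>"
      using 0 x aR bR by (simp add: smult_left_commute[of b a])
    then have "a \<odot>\<^bsub>M\<^esub> (b \<odot>\<^bsub>M\<^esub> (b \<odot>\<^bsub>M\<^esub> x)) = \<zero>\<^bsub>M\<^esub>"
      using separates_square_kernel[OF N a] car(2) x bR by simp
    then have "b \<odot>\<^bsub>M\<^esub> (b \<odot>\<^bsub>M\<^esub> (a \<odot>\<^bsub>M\<^esub> x)) = \<zero>\<^bsub>M\<^esub>"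
      using x aR bR by (simp add: smult_left_commute[of a b])
    then have "b \<odot>\<^bsub>M\<^esub> (a \<odot>\<^bsub>M\<^esub> x) = \<zero>\<^bsub>M\<^esub>"
      using separates_square_kernel[OF L b] car(1) x aR by simp
    then show ?thesis
      using x aR bR by (simp add: smult_left_commute[of a b])
  qed
  have "smult_image M (a \<otimes> b) \<subseteq> N"
  proof (rule maximal_disjoint_absorbs[OF N])
    show "submodule (smult_image M (a \<otimes> b)) R M"
      using aR bR by (simp add: submodule_smult_image)
    fix n k assume n: "n \<in> N" and k: "k \<in> smult_image M (a \<otimes> b)" and nk: "n \<oplus>\<^bsub>M\<^esub> k \<in> L"
    from k obtain x where x: "x \<in> carrier M" "k = a \<odot>\<^bsub>M\<^esub> (b \<odot>\<^bsub>M\<^esub> x)"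
      using aR bR by (auto simp: smult_image_def smult_assoc1)
    have nM: "n \<in> carrier M" and kM: "k \<in> carrier M"
      using n car x aR bR by auto
    have "b \<odot>\<^bsub>M\<^esub> (n \<oplus>\<^bsub>M\<^esub> k) = \<zero>\<^bsub>M\<^esub>" "b \<odot>\<^bsub>M\<^esub> n = n" "a \<odot>\<^bsub>M\<^esub> n = \<zero>\<^bsub>M\<^esub>"
      using a b n nk by (auto simp: separates_def)
    then have "n \<oplus>\<^bsub>M\<^esub> b \<odot>\<^bsub>M\<^esub> k = \<zero>\<^bsub>M\<^esub>"
      using bR nM kM by (simp add: smult_r_distr)
    then have "a \<odot>\<^bsub>M\<^esub> n \<oplus>\<^bsub>M\<^esub> a \<odot>\<^bsub>M\<^esub> (b \<odot>\<^bsub>M\<^esub> k) = \<zero>\<^bsub>M\<^esub>"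
      using aR bR nM kM by (simp flip: smult_r_distr)
    then have "a \<odot>\<^bsub>M\<^esub> (b \<odot>\<^bsub>M\<^esub> k) = \<zero>\<^bsub>M\<^esub>"
      using \<open>a \<odot>\<^bsub>M\<^esub> n = \<zero>\<^bsub>M\<^esub>\<close> aR bR kM by simp
    then have "k = \<zero>\<^bsub>M\<^esub>"
      using ab_kernel x by simp
    then show "n \<oplus>\<^bsub>M\<^esub> k = \<zero>\<^bsub>M\<^esub>"
      using n nk nM disj by auto
  qed
  then have "a \<odot>\<^bsub>M\<^esub> (b \<odot>\<^bsub>M\<^esub> y) \<in> N"
    using y aR bR by (auto simp: smult_image_def smult_assoc1)
  then have "a \<odot>\<^bsub>M\<^esub> (a \<odot>\<^bsub>M\<^esub> (b \<odot>\<^bsub>M\<^esub> y)) = \<zero>\<^bsub>M\<^esub>"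
    using a by (simp add: separates_def)
  then have "a \<odot>\<^bsub>M\<^esub> (b \<odot>\<^bsub>M\<^esub> y) = \<zero>\<^bsub>M\<^esub>"
    using separates_square_kernel[OF N a] car(2) y bR by simp
  then have "a \<odot>\<^bsub>M\<^esub> y \<ominus>\<^bsub>M\<^esub> a \<odot>\<^bsub>M\<^esub> (a \<odot>\<^bsub>M\<^esub> y) = \<zero>\<^bsub>M\<^esub>"
    using y aR by (simp add: b_act smult_diff_right)
  then show ?thesis
    using y aR by (simp add: M.diff_eq_zero_iff)
qed

definition idempotents_separate ::
  "('a, 'c) ring_scheme \<Rightarrow> ('a, 'b, 'd) module_scheme \<Rightarrow> bool"
  where "idempotents_separate R M \<longleftrightarrow>
    (\<forall>N L. submodule N R M \<longrightarrow> submodule L R M \<longrightarrow> N \<inter> L = {\<zero>\<^bsub>M\<^esub>} \<longrightarrow>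
      (\<exists>e. idempotent_elem R e \<and> separates R M N L e))"

text \<open>
  If \<open>L\<close> is essential in \<open>eM\<close>, then every \<open>N\<close> with \<open>N \<inter> L = 0\<close> misses \<open>eM\<close> altogether, while
  \<open>eN\<close> lies in both \<open>N\<close> and \<open>eM\<close>.
\<close>

lemma (in module) strongly_CS_imp_idempotents_separate:
  assumes "strongly_CS_module R M"
  shows "idempotents_separate R M"
  unfolding idempotents_separate_def
proof (intro allI impI)
  fix N L assume N: "submodule N R M" and L: "submodule L R M" and disj: "N \<inter> L = {\<zero>\<^bsub>M\<^esub>}"
  obtain e where e: "idempotent_elem R e"
    and ess: "essential_submodule R (M\<lparr>carrier := smult_image M e\<rparr>) L"
    using assms L unfolding strongly_CS_module_def by blast
  have eR: "e \<in> carrier R"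
    using e by (simp add: idempotent_elem_def)
  note eM = submodule_smult_image[OF eR]
  note ess = ess[unfolded essential_submodule_restrict_iff[OF eM]]
  have "L \<inter> (N \<inter> smult_image M e) = {\<zero>\<^bsub>M\<^esub>}"
    using disj submodule_zero_mem[OF eM] by blast
  then have "N \<inter> smult_image M e = {\<zero>\<^bsub>M\<^esub>}"
    using ess submodule_Int[OF N eM] by blast
  moreover have "e \<odot>\<^bsub>M\<^esub> x \<in> N \<inter> smult_image M e" if "x \<in> N" for x
    using that submoduleE(1,4)[OF N] eR by (auto simp: smult_image_def)
  ultimately have "separates R M N L e"
    using ess eR by (auto simp: separates_def smult_image_eq_fixed_points[OF e])
  with e show "\<exists>e. idempotent_elem R e \<and> separates R M N L e"
    by blast
qed

text \<open>
  The idempotent for \<open>N\<close> is obtained by separating it from a maximal submodule \<open>L\<close> that misses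
  it: a submodule of \<open>eM\<close> that misses \<open>N\<close> is absorbed by \<open>L\<close> and hence killed by \<open>e\<close>, which also
  fixes it.
\<close>

lemma (in module) idempotents_separate_imp_strongly_CS:
  assumes "idempotents_separate R M"
  shows "strongly_CS_module R M"
  unfolding strongly_CS_module_def
proof (intro allI impI)
  fix N assume N: "submodule N R M"
  have "submodule {\<zero>\<^bsub>M\<^esub>} R M" "{\<zero>\<^bsub>M\<^esub>} \<inter> N = {\<zero>\<^bsub>M\<^esub>}"
    using submodule_zero_mem[OF N] by (auto intro: submoduleI)
  then obtain L where L: "maximal_disjoint R M L N"
    using exists_maximal_disjoint by blast
  then have "submodule L R M" "L \<inter> N = {\<zero>\<^bsub>M\<^esub>}"
    by (auto simp: maximal_disjoint_def)
  then obtain e where e: "idempotent_elem R e" and sep: "separates R M L N e"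
    using assms N unfolding idempotents_separate_def by blast
  have eR: "e \<in> carrier R"
    using e by (simp add: idempotent_elem_def)
  have "essential_submodule R (M\<lparr>carrier := smult_image M e\<rparr>) N"
    unfolding essential_submodule_restrict_iff[OF submodule_smult_image[OF eR]]
  proof (intro conjI allI impI N)
    show "N \<subseteq> smult_image M e"
      using sep submoduleE(1)[OF N]
      by (auto simp: smult_image_eq_fixed_points[OF e] separates_def)
    fix K assume K: "submodule K R M" "K \<subseteq> smult_image M e" "N \<inter> K = {\<zero>\<^bsub>M\<^esub>}"
    have fix_K: "k \<in> carrier M" "e \<odot>\<^bsub>M\<^esub> k = k" if "k \<in> K" for k
      using that K by (auto simp: smult_image_eq_fixed_points[OF e])
    have "K \<subseteq> L"
    proof (rule maximal_disjoint_absorbs[OF L K(1)])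
      fix l k assume l: "l \<in> L" and k: "k \<in> K" and lk: "l \<oplus>\<^bsub>M\<^esub> k \<in> N"
      have "l \<in> carrier M"
        using l submoduleE(1)[OF \<open>submodule L R M\<close>] by auto
      then have "e \<odot>\<^bsub>M\<^esub> (l \<oplus>\<^bsub>M\<^esub> k) = k"
        using sep l fix_K[OF k] eR by (simp add: smult_r_distr separates_def)
      then have "l \<oplus>\<^bsub>M\<^esub> k = k"
        using sep lk by (simp add: separates_def)
      with lk k K(3) show "l \<oplus>\<^bsub>M\<^esub> k = \<zero>\<^bsub>M\<^esub>"
        by auto
    qed
    then have "k = \<zero>\<^bsub>M\<^esub>" if "k \<in> K" for k
      using that fix_K[OF that] sep by (auto simp: separates_def)
    then show "K = {\<zero>\<^bsub>M\<^esub>}"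
      using submodule_zero_mem[OF K(1)] by blast
  qed
  with e show "\<exists>e. idempotent_elem R e \<and>
      essential_submodule R (M\<lparr>carrier := smult_image M e\<rparr>) N"
    by blast
qed

lemma (in module) idempotents_separate_imp_weakly_IN:
  assumes "idempotents_separate R M"
  shows "weakly_IN_module R M"
  using assms unfolding weakly_IN_iff_separates idempotents_separate_def by blast

lemma (in module) idempotents_lift_annihilator_iff:
  "idempotents_lift R (annihilator R M (carrier M)) \<longleftrightarrow>
    (\<forall>r\<in>carrier R. (\<forall>x\<in>carrier M. r \<odot>\<^bsub>M\<^esub> (r \<odot>\<^bsub>M\<^esub> x) = r \<odot>\<^bsub>M\<^esub> x) \<longrightarrow>
      (\<exists>e. idempotent_elem R e \<and> (\<forall>x\<in>carrier M. e \<odot>\<^bsub>M\<^esub> x = r \<odot>\<^bsub>M\<^esub> x)))"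
proof -
  have "r \<ominus> r \<otimes> r \<in> annihilator R M (carrier M) \<longleftrightarrow>
      (\<forall>x\<in>carrier M. r \<odot>\<^bsub>M\<^esub> (r \<odot>\<^bsub>M\<^esub> x) = r \<odot>\<^bsub>M\<^esub> x)" if "r \<in> carrier R" for r
    using that by (subst diff_in_annihilator_iff) (auto simp: smult_assoc1)
  moreover have "(idempotent_elem R e \<and> r \<ominus> e \<in> annihilator R M (carrier M)) \<longleftrightarrow>
      (idempotent_elem R e \<and> (\<forall>x\<in>carrier M. e \<odot>\<^bsub>M\<^esub> x = r \<odot>\<^bsub>M\<^esub> x))" if "r \<in> carrier R" for r e
    using that diff_in_annihilator_iff[of r e "carrier M"] by (auto simp: idempotent_elem_def)
  ultimately show ?thesis
    unfolding idempotents_lift_def by simp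
qed

text \<open>
  A scalar that is idempotent on \<open>M\<close> splits \<open>M\<close> into its kernel and its image. An idempotent that
  separates these two submodules acts as \<open>r\<close> on both, and so on \<open>M\<close>.
\<close>

lemma (in module) idempotents_separate_imp_lift:
  assumes "idempotents_separate R M"
  shows "idempotents_lift R (annihilator R M (carrier M))"
  unfolding idempotents_lift_annihilator_iff
proof (intro ballI impI)
  fix r assume r: "r \<in> carrier R"
    and idem: "\<forall>x\<in>carrier M. r \<odot>\<^bsub>M\<^esub> (r \<odot>\<^bsub>M\<^esub> x) = r \<odot>\<^bsub>M\<^esub> x"
  have "smult_kernel M r \<inter> smult_image M r = {\<zero>\<^bsub>M\<^esub>}"
    using idem submodule_zero_mem[OF submodule_smult_kernel[OF r]]
      submodule_zero_mem[OF submodule_smult_image[OF r]]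
    by (auto simp: smult_kernel_def smult_image_def)
  then obtain e where e: "idempotent_elem R e"
      and sep: "separates R M (smult_kernel M r) (smult_image M r) e"
    using assms submodule_smult_kernel[OF r] submodule_smult_image[OF r]
    unfolding idempotents_separate_def by blast
  have eR: "e \<in> carrier R"
    using e by (simp add: idempotent_elem_def)
  have "e \<odot>\<^bsub>M\<^esub> x = r \<odot>\<^bsub>M\<^esub> x" if x: "x \<in> carrier M" for x
  proof -
    have "x \<ominus>\<^bsub>M\<^esub> r \<odot>\<^bsub>M\<^esub> x \<in> smult_kernel M r" "r \<odot>\<^bsub>M\<^esub> x \<in> smult_image M r"
      using x r idem by (auto simp: smult_kernel_def smult_image_def smult_diff_right M.diff_eq_zero_iff)
    then have "e \<odot>\<^bsub>M\<^esub> (x \<ominus>\<^bsub>M\<^esub> r \<odot>\<^bsub>M\<^esub> x) = \<zero>\<^bsub>M\<^esub>" "e \<odot>\<^bsub>M\<^esub> (r \<odot>\<^bsub>M\<^esub> x) = r \<odot>\<^bsub>M\<^esub> x"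
      using sep by (auto simp: separates_def)
    then show ?thesis
      using x r eR by (simp add: smult_diff_right M.diff_eq_zero_iff)
  qed
  with e show "\<exists>e. idempotent_elem R e \<and> (\<forall>x\<in>carrier M. e \<odot>\<^bsub>M\<^esub> x = r \<odot>\<^bsub>M\<^esub> x)"
    by blast
qed

text \<open>
  Enlarging \<open>N\<close> and \<open>L\<close> to a pair in which each is maximal with respect to the other makes the
  separating scalar idempotent on \<open>M\<close>, so that it lifts to an idempotent with the same action.
\<close>

lemma (in module) weakly_IN_lift_imp_idempotents_separate:
  assumes IN: "weakly_IN_module R M"
    and lift: "idempotents_lift R (annihilator R M (carrier M))"
  shows "idempotents_separate R M"
  unfolding idempotents_separate_def
proof (intro allI impI)
  fix N L assume N: "submodule N R M" and L: "submodule L R M" and disj: "N \<inter> L = {\<zero>\<^bsub>M\<^esub>}"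
  obtain N' where N': "N \<subseteq> N'" "maximal_disjoint R M N' L"
    using exists_maximal_disjoint[OF N disj] .
  then have "L \<inter> N' = {\<zero>\<^bsub>M\<^esub>}"
    by (auto simp: maximal_disjoint_def)
  then obtain L' where L': "L \<subseteq> L'" "maximal_disjoint R M L' N'"
    using exists_maximal_disjoint[OF L] by blast
  \<comment> \<open>A submodule that misses the larger module \<open>L'\<close> also misses \<open>L\<close>, so \<open>N'\<close> stays maximal.\<close>
  have sub: "submodule N' R M" "submodule L' R M" and disj': "N' \<inter> L' = {\<zero>\<^bsub>M\<^esub>}"
    using N' L' by (auto simp: maximal_disjoint_def)
  have "X \<inter> L = {\<zero>\<^bsub>M\<^esub>}" if "X \<inter> L' = {\<zero>\<^bsub>M\<^esub>}" for X
    using that L'(1) submodule_zero_mem[OF L] by blast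
  then have max: "maximal_disjoint R M N' L'"
    using N'(2) disj' unfolding maximal_disjoint_def by blast
  obtain a where a: "separates R M N' L' a"
    using IN sub disj' unfolding weakly_IN_iff_separates by blast
  then have "a \<in> carrier R"
    by (simp add: separates_def)
  then obtain e where e: "idempotent_elem R e" "\<forall>x\<in>carrier M. e \<odot>\<^bsub>M\<^esub> x = a \<odot>\<^bsub>M\<^esub> x"
    using lift separating_scalar_idempotent_on_module[OF max L'(2) a]
    unfolding idempotents_lift_annihilator_iff by blast
  have "separates R M N L e"
    using e a N'(1) L'(1) submoduleE(1)[OF N] submoduleE(1)[OF L]
    by (auto simp: separates_def idempotent_elem_def subset_eq)
  with e show "\<exists>e. idempotent_elem R e \<and> separates R M N L e"
    by blast
qed

lemma (in module) direct_summand_smult_image: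
  assumes e: "idempotent_elem R e"
  shows "direct_summand R M (smult_image M e)"
proof -
  have eR: "e \<in> carrier R"
    using e by (simp add: idempotent_elem_def)
  note fixed = smult_image_eq_fixed_points[OF e]
  note im = submodule_smult_image[OF eR] and ker = submodule_smult_kernel[OF eR]
  have "smult_image M e \<inter> smult_kernel M e = {\<zero>\<^bsub>M\<^esub>}"
    using submodule_zero_mem[OF im] submodule_zero_mem[OF ker]
    by (auto simp: fixed smult_kernel_def)
  moreover have "x \<in> smult_image M e <+>\<^bsub>M\<^esub> smult_kernel M e" if x: "x \<in> carrier M" for x
  proof -
    have ex: "e \<odot>\<^bsub>M\<^esub> x \<in> smult_image M e"
      using x by (simp add: smult_image_def)
    then have "x \<ominus>\<^bsub>M\<^esub> e \<odot>\<^bsub>M\<^esub> x \<in> smult_kernel M e"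
      using x eR by (simp add: fixed smult_kernel_def smult_diff_right M.diff_eq_zero_iff)
    moreover have "x = e \<odot>\<^bsub>M\<^esub> x \<oplus>\<^bsub>M\<^esub> (x \<ominus>\<^bsub>M\<^esub> e \<odot>\<^bsub>M\<^esub> x)"
      using x eR by (simp add: M.minus_eq M.a_lcomm M.r_neg)
    ultimately show ?thesis
      using ex unfolding set_add_def' by blast
  qed
  ultimately have "\<exists>L. submodule L R M \<and> smult_image M e \<inter> L = {\<zero>\<^bsub>M\<^esub>} \<and>
      smult_image M e <+>\<^bsub>M\<^esub> L = carrier M"
    using ker submoduleE(1)[OF submodule_set_add(1)[OF im ker]]
    by (intro exI[of _ "smult_kernel M e"]) blast
  with im show ?thesis
    by (simp add: direct_summand_def)
qed

lemma (in module) separates_direct_sum_eq_smult_image: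
  assumes e: "idempotent_elem R e" and sep: "separates R M L K e"
    and K: "submodule K R M" and L: "submodule L R M" and sum: "K <+>\<^bsub>M\<^esub> L = carrier M"
  shows "K = smult_image M e"
proof
  note fixed = smult_image_eq_fixed_points[OF e]
  show "K \<subseteq> smult_image M e"
    using sep submoduleE(1)[OF K] by (auto simp: fixed separates_def)
  show "smult_image M e \<subseteq> K"
  proof
    fix x assume x: "x \<in> smult_image M e"
    then have "x \<in> K <+>\<^bsub>M\<^esub> L"
      by (simp add: fixed sum)
    then obtain k l where kl: "k \<in> K" "l \<in> L" "x = k \<oplus>\<^bsub>M\<^esub> l"
      by (auto simp: set_add_def')
    then have "k \<in> carrier M" "l \<in> carrier M"
      using submoduleE(1)[OF K] submoduleE(1)[OF L] by auto
    then have "e \<odot>\<^bsub>M\<^esub> x = k"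
      using kl sep by (simp add: separates_def smult_r_distr)
    then show "x \<in> K"
      using x kl by (simp add: fixed)
  qed
qed

lemma (in module) idempotents_separate_imp_summand_smult_image:
  assumes "idempotents_separate R M" and "direct_summand R M K"
  shows "\<exists>e. idempotent_elem R e \<and> K = smult_image M e"
proof -
  from assms(2) obtain L where KL: "submodule K R M" "submodule L R M"
      "L \<inter> K = {\<zero>\<^bsub>M\<^esub>}" "K <+>\<^bsub>M\<^esub> L = carrier M"
    by (auto simp: direct_summand_def Int_commute)
  then obtain e where "idempotent_elem R e" "separates R M L K e"
    using assms(1) unfolding idempotents_separate_def by blast
  with KL separates_direct_sum_eq_smult_image show ?thesis
    by blast
qed

lemma (in module) strongly_CS_imp_CS:
  assumes "strongly_CS_module R M"
  shows "CS_module R M"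
  using assms direct_summand_smult_image
  unfolding strongly_CS_module_def CS_module_def by blast

lemma CS_summands_smult_image_imp_strongly_CS:
  assumes "CS_module R M"
    and "\<And>K. direct_summand R M K \<Longrightarrow> \<exists>e. idempotent_elem R e \<and> K = smult_image M e"
  shows "strongly_CS_module R M"
  using assms unfolding strongly_CS_module_def CS_module_def by blast

theorem theorem2p8:
  fixes R :: "('a, 'c) ring_scheme" and M :: "('a, 'b, 'd) module_scheme"
  assumes "module R M"
    and "carrier M \<noteq> {\<zero>\<^bsub>M\<^esub>}"
  defines "cond1 \<equiv> strongly_CS_module R M"
    and "cond2 \<equiv>
      (\<forall>N L. submodule N R M \<longrightarrow> submodule L R M \<longrightarrow> N \<inter> L = {\<zero>\<^bsub>M\<^esub>} \<longrightarrow>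
        (\<exists>e. idempotent_elem R e \<and> e \<in> annihilator R M N \<and>
          \<one>\<^bsub>R\<^esub> \<ominus>\<^bsub>R\<^esub> e \<in> annihilator R M L))"
    and "cond3 \<equiv> weakly_IN_module R M \<and> idempotents_lift R (annihilator R M (carrier M))"
    and "cond4 \<equiv> CS_module R M \<and>
      (\<forall>K. direct_summand R M K \<longrightarrow> (\<exists>e. idempotent_elem R e \<and> K = smult_image M e))"
  shows "(cond1 \<longleftrightarrow> cond2) \<and> (cond2 \<longleftrightarrow> cond3) \<and> (cond3 \<longleftrightarrow> cond4)"
proof -
  interpret module R M
    by (rule assms(1))
  have "separates R M N L e \<longleftrightarrow> e \<in> annihilator R M N \<and> \<one>\<^bsub>R\<^esub> \<ominus>\<^bsub>R\<^esub> e \<in> annihilator R M L"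
    if "submodule L R M" "idempotent_elem R e" for N L e
    using that separates_iff_annihilator[OF submoduleE(1)] by (auto simp: idempotent_elem_def)
  then have cond2: "cond2 \<longleftrightarrow> idempotents_separate R M"
    unfolding cond2_def idempotents_separate_def by metis
  have "cond1 \<longleftrightarrow> cond2"
    unfolding cond1_def cond2
    using strongly_CS_imp_idempotents_separate idempotents_separate_imp_strongly_CS by blast
  moreover have "cond2 \<longleftrightarrow> cond3"
    unfolding cond3_def cond2
    using idempotents_separate_imp_weakly_IN idempotents_separate_imp_lift
      weakly_IN_lift_imp_idempotents_separate by blast
  moreover have "cond2 \<longleftrightarrow> cond4"
  proof
    assume cond2
    then show cond4
      unfolding cond4_def
      using \<open>cond1 \<longleftrightarrow> cond2\<close> cond1_def cond2 strongly_CS_imp_CS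
        idempotents_separate_imp_summand_smult_image by blast
  next
    assume cond4
    then have cond1
      unfolding cond1_def cond4_def
      using CS_summands_smult_image_imp_strongly_CS by blast
    then show cond2
      using \<open>cond1 \<longleftrightarrow> cond2\<close> by blast
  qed
  ultimately show ?thesis
    by blast
qed

end
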